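(* Let $w\in\mathbb{C}\setminus\{0\}$. For $0<q<1$ let $\mathcal{D}_q$ be the Dirac operator on the standard Podleś sphere with parameters $q,w$, and let $\mathcal{D}_1$ be $|w|$ times the usual Dirac operator on the 2-sphere. Then $$\lim_{q\to1}\operatorname{Tr}e^{-t|\mathcal{D}_q|}=\operatorname{Tr}e^{-t|\mathcal{D}_1|}\qquad\text{for every }t>0.$$
   Context: $\mathbb{N}=\{0,1,2,\dots\}$; the limit is over $0<q<1$, $q\uparrow1$. For $0<q<1$ set $[n]_q:=\frac{q^{-n}-q^n}{q^{-1}-q}$. Let $\mathcal{H}_{1/2}$ be the Hilbert space with orthonormal basis $|l,m\rangle$, $l\in\frac12+\mathbb{N}$, $m\in\{-l,-l+1,\dots,l\}$, and $\mathcal{H}=\mathcal{H}_{1/2}\oplus\mathcal{H}_{1/2}$. Let $D_q|l,m\rangle=[l+\frac12]_q|l,m\rangle$ and $\mathcal{D}_q=\begin{pmatrix}0&\bar wD_q\\ wD_q&0\end{pmatrix}$, so $|\mathcal{D}_q|=|w|(D_q\oplus D_q)$. On the same Hilbert space, $|\mathcal{D}_1|$ is identified with the operator having the same eigenspaces as $|\mathcal{D}_q|$, with eigenvalue $|w|(l+\frac12)$ on each basis vector $|l,m\rangle$ of each copy of $\mathcal{H}_{1/2}$ (that is, eigenvalues $|w|n$, $n\ge1$, with multiplicity $4n$). *)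

theory Defs
  imports "HOL-Analysis.Analysis"
begin

section \<open>The Hilbert space of square-summable families over an index set\<close>

text \<open>Families are extended by zero outside the index set.\<close>

definition ell2 :: "'i set \<Rightarrow> ('i \<Rightarrow> complex) set" where
  "ell2 I = {x. (\<forall>i. i \<notin> I \<longrightarrow> x i = 0) \<and> (\<lambda>i. (cmod (x i))\<^sup>2) summable_on I}"

definition ell2_inner :: "'i set \<Rightarrow> ('i \<Rightarrow> complex) \<Rightarrow> ('i \<Rightarrow> complex) \<Rightarrow> complex" where
  "ell2_inner I x y = (\<Sum>\<^sub>\<infinity>i\<in>I. cnj (x i) * y i)"

definition ell2_norm :: "'i set \<Rightarrow> ('i \<Rightarrow> complex) \<Rightarrow> real" where
  "ell2_norm I x = sqrt (\<Sum>\<^sub>\<infinity>i\<in>I. (cmod (x i))\<^sup>2)"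

definition ket :: "'i \<Rightarrow> 'i \<Rightarrow> complex" where
  "ket i = (\<lambda>j. if j = i then 1 else 0)"

section \<open>Unbounded operators\<close>

text \<open>A (possibly unbounded, possibly not everywhere defined) operator is represented by its graph.
  Hence \<open>S O T\<close> is the operator product usually written \<open>T S\<close>, on its natural domain.\<close>

type_synonym 'i op = "(('i \<Rightarrow> complex) \<times> ('i \<Rightarrow> complex)) set"

definition linear_operator :: "'i set \<Rightarrow> 'i op \<Rightarrow> bool" where
  "linear_operator I T \<longleftrightarrow>
     T \<subseteq> ell2 I \<times> ell2 I \<and> single_valued T \<and> ((\<lambda>_. 0), (\<lambda>_. 0)) \<in> T \<and>
     (\<forall>x y x' y' c. (x, y) \<in> T \<longrightarrow> (x', y') \<in> T \<longrightarrow>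
        ((\<lambda>i. c * x i + x' i), (\<lambda>i. c * y i + y' i)) \<in> T)"

definition op_apply :: "'i op \<Rightarrow> ('i \<Rightarrow> complex) \<Rightarrow> ('i \<Rightarrow> complex)" where
  "op_apply T x = (THE y. (x, y) \<in> T)"

definition bounded_operator :: "'i set \<Rightarrow> 'i op \<Rightarrow> bool" where
  "bounded_operator I T \<longleftrightarrow>
     linear_operator I T \<and> Domain T = ell2 I \<and>
     (\<exists>C. \<forall>(x, y) \<in> T. ell2_norm I y \<le> C * ell2_norm I x)"

definition op_adjoint :: "'i set \<Rightarrow> 'i op \<Rightarrow> 'i op" where
  "op_adjoint I T =
     {(y, z). y \<in> ell2 I \<and> z \<in> ell2 I \<and>
        (\<forall>(x, x') \<in> T. ell2_inner I y x' = ell2_inner I z x)}"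

text \<open>Density of the domain need not be demanded: the vectors orthogonal to the domain
  of \<open>T\<close> are exactly those related to \<open>0\<close> by \<open>op_adjoint I T\<close>, so a single-valued
  \<open>T\<close> that equals its adjoint is densely defined.\<close>

definition self_adjoint :: "'i set \<Rightarrow> 'i op \<Rightarrow> bool" where
  "self_adjoint I T \<longleftrightarrow> linear_operator I T \<and> op_adjoint I T = T"

definition positive_self_adjoint :: "'i set \<Rightarrow> 'i op \<Rightarrow> bool" where
  "positive_self_adjoint I T \<longleftrightarrow>
     self_adjoint I T \<and> (\<forall>(x, y) \<in> T. 0 \<le> Re (ell2_inner I x y))"

text \<open>The absolute value of a closed densely defined \<open>T\<close> is the positive self-adjoint
  square root of \<open>T\<^sup>* T\<close>.\<close>

definition op_abs :: "'i set \<Rightarrow> 'i op \<Rightarrow> 'i op" where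
  "op_abs I T = (THE A. positive_self_adjoint I A \<and> A O A = T O op_adjoint I T)"

text \<open>Functional calculus for a self-adjoint operator \<open>A\<close> whose eigenvectors span a dense
  subspace and a function \<open>f\<close> bounded on its eigenvalues: \<open>f(A)\<close> is the bounded operator that acts on
  every eigenvector of \<open>A\<close>, with eigenvalue \<open>s\<close>, as multiplication by \<open>f s\<close>.
  For other \<open>A\<close> or \<open>f\<close> the description need not determine an operator.\<close>

definition op_fun :: "'i set \<Rightarrow> (real \<Rightarrow> complex) \<Rightarrow> 'i op \<Rightarrow> 'i op" where
  "op_fun I f A = (THE B. bounded_operator I B \<and>
     (\<forall>x s. (x, (\<lambda>i. of_real s * x i)) \<in> A \<longrightarrow> (x, (\<lambda>i. f s * x i)) \<in> B))"

definition op_exp_neg :: "'i set \<Rightarrow> real \<Rightarrow> 'i op \<Rightarrow> 'i op" where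
  "op_exp_neg I t A = op_fun I (\<lambda>s. of_real (exp (- t * s))) A"

definition trace_class :: "'i set \<Rightarrow> 'i op \<Rightarrow> bool" where
  "trace_class I T \<longleftrightarrow>
     bounded_operator I T \<and>
     (\<lambda>i. ell2_inner I (ket i) (op_apply (op_abs I T) (ket i))) summable_on I"

definition op_trace :: "'i set \<Rightarrow> 'i op \<Rightarrow> complex" where
  "op_trace I T = (\<Sum>\<^sub>\<infinity>i\<in>I. ell2_inner I (ket i) (op_apply T (ket i)))"

definition op_scale :: "complex \<Rightarrow> 'i op \<Rightarrow> 'i op" where
  "op_scale c T = (\<lambda>(x, y). (x, (\<lambda>i. c * y i))) ` T"

text \<open>The operator \<open>ket i \<mapsto> a i ket i\<close> on its maximal domain, which is the closure of its
  restriction to finite linear combinations of the \<open>ket i\<close>.\<close>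

definition diag_op :: "'i set \<Rightarrow> ('i \<Rightarrow> complex) \<Rightarrow> 'i op" where
  "diag_op I a = {(x, y). x \<in> ell2 I \<and> y \<in> ell2 I \<and> (\<forall>i\<in>I. y i = a i * x i)}"

text \<open>The direct sum \<open>ell2 I \<oplus> ell2 J\<close> is \<open>ell2 (I <+> J)\<close>, and \<open>x\<close> has the components
  \<open>x \<circ> Inl\<close> and \<open>x \<circ> Inr\<close>. The following are the block operators with rows
  \<open>(A, 0), (0, B)\<close> and \<open>(0, A), (B, 0)\<close>.\<close>

definition block_diag :: "'i op \<Rightarrow> 'i op \<Rightarrow> ('i + 'i) op" where
  "block_diag A B = {(x, y). (x \<circ> Inl, y \<circ> Inl) \<in> A \<and> (x \<circ> Inr, y \<circ> Inr) \<in> B}"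

definition block_antidiag :: "'i op \<Rightarrow> 'i op \<Rightarrow> ('i + 'i) op" where
  "block_antidiag A B = {(x, y). (x \<circ> Inr, y \<circ> Inl) \<in> A \<and> (x \<circ> Inl, y \<circ> Inr) \<in> B}"

section \<open>Dirac operators\<close>

definition qnum :: "real \<Rightarrow> real \<Rightarrow> real" where
  "qnum q n = (q powr (- n) - q powr n) / (inverse q - q)"

definition spin_idx :: "(real \<times> real) set" where
  "spin_idx = {(l, m). (\<exists>n::nat. l = 1 / 2 + real n) \<and> (\<exists>j::nat. m = - l + real j) \<and> m \<le> l}"

definition spinor_idx :: "(real \<times> real + real \<times> real) set" where
  "spinor_idx = spin_idx <+> spin_idx"

definition half_dirac :: "real \<Rightarrow> (real \<times> real) op" where
  "half_dirac q = diag_op spin_idx (\<lambda>(l, m). of_real (qnum q (l + 1 / 2)))"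

definition podles_dirac :: "real \<Rightarrow> complex \<Rightarrow> (real \<times> real + real \<times> real) op" where
  "podles_dirac q w =
     block_antidiag (op_scale (cnj w) (half_dirac q)) (op_scale w (half_dirac q))"

text \<open>The absolute value of \<open>|w|\<close> times the Dirac operator on the round 2-sphere, transported to
  the space spanned by the \<open>|l,m\<rangle>\<close>: the eigenvalues are \<open>|w| n\<close> with \<open>n = l + 1/2 \<ge> 1\<close>, each of
  multiplicity \<open>4 n\<close> (\<open>2 l + 1 = 2 n\<close> values of \<open>m\<close> in each of the two summands).\<close>

definition abs_sphere_dirac :: "complex \<Rightarrow> (real \<times> real + real \<times> real) op" where
  "abs_sphere_dirac w =
     (let A = diag_op spin_idx (\<lambda>(l, m). of_real (cmod w * (l + 1 / 2)))
      in block_diag A A)"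

end

theory Submission
  imports Defs "HOL-Real_Asymp.Real_Asymp"
begin

text \<open>The operator \<open>T\<close> given by \<open>(T x) i = a i * x (s i)\<close> for an involution \<open>s\<close> of the index set
  has an adjoint of the same shape, and \<open>T\<^sup>* T\<close> is diagonal. A positive self-adjoint square root of
  a diagonal operator with positive entries is forced on the basis vectors, hence everywhere by
  self-adjointness. So \<open>|\<D>\<^sub>q|\<close> is diagonal with entries \<open>|w| [n]\<^sub>q\<close>, and both heat traces are sums of
  exponentials. Writing \<open>q = exp (- h)\<close>, we have \<open>[n]\<^sub>q = sinh (n h) / sinh h \<ge> n\<close>, so the summable
  family \<open>exp (- t |w| n)\<close> dominates the series uniformly in \<open>q\<close>, and the limit \<open>[n]\<^sub>q \<rightarrow> n\<close> can be
  taken termwise.\<close>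

section \<open>Square-summable families\<close>

lemma ell2_zero [simp]: "(\<lambda>_. 0) \<in> ell2 I"
  by (simp add: ell2_def)

lemma ell2_outside: "x \<in> ell2 I \<Longrightarrow> i \<notin> I \<Longrightarrow> x i = 0"
  by (simp add: ell2_def)

lemma ell2_summable: "x \<in> ell2 I \<Longrightarrow> (\<lambda>i. (cmod (x i))\<^sup>2) summable_on I"
  by (simp add: ell2_def)

text \<open>Comparison with two vectors at once: the domain argument for \<open>T\<^sup>* T\<close>
  needs a bound by a vector and its image together.\<close>

lemma ell2_dominated:
  assumes "x \<in> ell2 I" and "y \<in> ell2 I" and "\<And>i. i \<notin> I \<Longrightarrow> z i = 0"
    and "\<And>i. i \<in> I \<Longrightarrow> (cmod (z i))\<^sup>2 \<le> C * (cmod (x i))\<^sup>2 + D * (cmod (y i))\<^sup>2"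
  shows "z \<in> ell2 I"
proof -
  have "(\<lambda>i. C * (cmod (x i))\<^sup>2 + D * (cmod (y i))\<^sup>2) summable_on I"
    using assms(1,2) by (intro summable_on_add summable_on_cmult_right ell2_summable)
  then have "(\<lambda>i. (cmod (z i))\<^sup>2) summable_on I"
    by (rule summable_on_comparison_test) (use assms(4) in auto)
  then show ?thesis
    using assms(3) by (auto simp: ell2_def)
qed

lemma ell2_comb:
  assumes "x \<in> ell2 I" and "y \<in> ell2 I"
  shows "(\<lambda>i. c * x i + y i) \<in> ell2 I"
proof (rule ell2_dominated[OF assms])
  fix i
  have "(cmod (c * x i + y i))\<^sup>2 \<le> (cmod (c * x i) + cmod (y i))\<^sup>2"
    by (intro power_mono norm_triangle_ineq) auto
  also have "\<dots> \<le> 2 * (cmod (c * x i))\<^sup>2 + 2 * (cmod (y i))\<^sup>2"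
    using sum_squares_bound[of "cmod (c * x i)" "cmod (y i)"] by (simp add: power2_sum)
  also have "\<dots> = (2 * (cmod c)\<^sup>2) * (cmod (x i))\<^sup>2 + 2 * (cmod (y i))\<^sup>2"
    by (simp add: norm_mult power_mult_distrib)
  finally show "(cmod (c * x i + y i))\<^sup>2 \<le> (2 * (cmod c)\<^sup>2) * (cmod (x i))\<^sup>2 + 2 * (cmod (y i))\<^sup>2" .
qed (use assms in \<open>auto simp: ell2_def\<close>)

lemma ell2_scale: "x \<in> ell2 I \<Longrightarrow> (\<lambda>i. c * x i) \<in> ell2 I"
  using ell2_comb[of x I "\<lambda>_. 0" c] by simp

lemma ell2_ket_scaled:
  assumes "k \<in> I"
  shows "(\<lambda>j. c * ket k j) \<in> ell2 I"
proof -
  have "(\<lambda>i. (cmod (ket k i))\<^sup>2) summable_on I \<longleftrightarrow> (\<lambda>i. (cmod (ket k i))\<^sup>2) summable_on {k}"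
    using assms by (intro summable_on_cong_neutral) (auto simp: ket_def)
  then have "ket k \<in> ell2 I"
    using assms by (auto simp: ell2_def ket_def)
  then show ?thesis by (rule ell2_scale)
qed

lemma ell2_ket: "k \<in> I \<Longrightarrow> ket k \<in> ell2 I"
  using ell2_ket_scaled[of k I 1] by simp

lemma ell2_inner_ket_right:
  assumes "k \<in> I"
  shows "ell2_inner I y (\<lambda>j. c * ket k j) = cnj (y k) * c"
proof -
  have "ell2_inner I y (\<lambda>j. c * ket k j) = (\<Sum>\<^sub>\<infinity>i\<in>{k}. cnj (y i) * (c * ket k i))"
    unfolding ell2_inner_def using assms by (intro infsum_cong_neutral) (auto simp: ket_def)
  then show ?thesis by (simp add: ket_def)
qed

lemma ell2_inner_ket_left:
  assumes "k \<in> I"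
  shows "ell2_inner I (ket k) y = y k"
proof -
  have "ell2_inner I (ket k) y = (\<Sum>\<^sub>\<infinity>i\<in>{k}. cnj (ket k i) * y i)"
    unfolding ell2_inner_def using assms by (intro infsum_cong_neutral) (auto simp: ket_def)
  then show ?thesis by (simp add: ket_def)
qed

text \<open>Makes the quadratic form of a real diagonal operator visibly real, so that positivity
  can be tested on it. Summability need not be checked: the real and the complex family are summable
  together, and otherwise both sums are 0 by convention.\<close>

lemma ell2_inner_real_weight:
  assumes "\<And>i. i \<in> I \<Longrightarrow> y i = of_real (a i) * x i"
  shows "ell2_inner I x y = of_real (\<Sum>\<^sub>\<infinity>i\<in>I. a i * (cmod (x i))\<^sup>2)"
proof -
  have "ell2_inner I x y = (\<Sum>\<^sub>\<infinity>i\<in>I. of_real (a i * (cmod (x i))\<^sup>2))"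
    unfolding ell2_inner_def using assms
    by (intro infsum_cong) (simp add: complex_norm_square mult_ac del: of_real_power)
  also have "\<dots> = of_real (\<Sum>\<^sub>\<infinity>i\<in>I. a i * (cmod (x i))\<^sup>2)"
  proof (rule infsum_bounded_linear_strong[OF _ bounded_linear_of_real])
    show "(\<lambda>i. complex_of_real (a i * (cmod (x i))\<^sup>2)) summable_on I \<longleftrightarrow>
        (\<lambda>i. a i * (cmod (x i))\<^sup>2) summable_on I"
      by (rule summable_on_bounded_linear_iff[OF bounded_linear_of_real bounded_linear_Re]) simp
  qed
  finally show ?thesis .
qed

lemma ell2_norm_coordinate:
  assumes "x \<in> ell2 I" and "i \<in> I"
  shows "cmod (x i) \<le> ell2_norm I x"
proof -
  have "sum (\<lambda>i. (cmod (x i))\<^sup>2) {i} \<le> (\<Sum>\<^sub>\<infinity>i\<in>I. (cmod (x i))\<^sup>2)"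
    using assms by (intro finite_sum_le_infsum ell2_summable) auto
  then show ?thesis
    by (auto simp: ell2_norm_def intro: real_le_rsqrt)
qed

section \<open>Weighted permutation operators\<close>

text \<open>One shape for both kinds of operator that occur: the identity for \<open>s\<close> gives
  diagonal operators, the exchange of the two summands gives off-diagonal blocks.\<close>

definition perm_op :: "'i set \<Rightarrow> ('i \<Rightarrow> 'i) \<Rightarrow> ('i \<Rightarrow> complex) \<Rightarrow> 'i op" where
  "perm_op I s a = {(x, y). x \<in> ell2 I \<and> y \<in> ell2 I \<and> (\<forall>i\<in>I. y i = a i * x (s i))}"

lemma diag_op_eq_perm_op: "diag_op I a = perm_op I (\<lambda>i. i) a"
  by (simp add: diag_op_def perm_op_def)

lemma diag_op_cong:
  assumes "\<And>i. i \<in> I \<Longrightarrow> a i = b i"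
  shows "diag_op I a = diag_op I b"
  using assms by (auto simp: diag_op_def)

lemma linear_operator_perm_op: "linear_operator I (perm_op I s a)"
proof -
  have "single_valued (perm_op I s a)"
  proof (rule single_valuedI)
    fix x y z assume "(x, y) \<in> perm_op I s a" "(x, z) \<in> perm_op I s a"
    \<comment> \<open>Off \<open>I\<close> both families vanish, so agreement on \<open>I\<close>
      already gives equality as functions.\<close>
    then have "y i = z i" for i
      by (cases "i \<in> I") (auto simp: perm_op_def ell2_outside)
    then show "y = z" by auto
  qed
  then show ?thesis
    unfolding linear_operator_def by (auto simp: perm_op_def ell2_comb) (simp add: algebra_simps)
qed

text \<open>Testing the adjoint relation on basis vectors fixes every coordinate of the image;
  conversely, reindexing the inner product along the bijection \<open>s\<close> moves the weight to
  the other side. Both operators carry their maximal domain, so the graphs coincide.\<close>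

lemma op_adjoint_perm_op:
  assumes s: "\<And>i. i \<in> I \<Longrightarrow> s i \<in> I" and ss: "\<And>i. s (s i) = i"
  shows "op_adjoint I (perm_op I s a) = perm_op I s (\<lambda>i. cnj (a (s i)))"
proof (intro set_eqI iffI)
  fix p assume "p \<in> op_adjoint I (perm_op I s a)"
  then obtain y z where p: "p = (y, z)" and yz: "y \<in> ell2 I" "z \<in> ell2 I"
    and adj: "\<And>x x'. (x, x') \<in> perm_op I s a \<Longrightarrow> ell2_inner I y x' = ell2_inner I z x"
    unfolding op_adjoint_def by blast
  have "z i = cnj (a (s i)) * y (s i)" if i: "i \<in> I" for i
  proof -
    \<comment> \<open>Since \<open>s\<close> is an involution, \<open>s j = i\<close> happens only
      for \<open>j = s i\<close>.\<close>
    have "(ket i, \<lambda>j. a (s i) * ket (s i) j) \<in> perm_op I s a"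
      using s[OF i] i ss by (auto simp: perm_op_def ell2_ket ell2_ket_scaled) (auto simp: ket_def)
    from adj[OF this] have "cnj (y (s i)) * a (s i) = cnj (z i)"
      using ell2_inner_ket_right[OF s[OF i], of y "a (s i)"] ell2_inner_ket_right[OF i, of z 1]
      by simp
    then show ?thesis
      by (metis complex_cnj_cnj complex_cnj_mult mult.commute)
  qed
  then show "p \<in> perm_op I s (\<lambda>i. cnj (a (s i)))"
    using p yz by (auto simp: perm_op_def)
next
  fix p assume "p \<in> perm_op I s (\<lambda>i. cnj (a (s i)))"
  then obtain y z where p: "p = (y, z)" and yz: "y \<in> ell2 I" "z \<in> ell2 I"
    and z: "\<And>i. i \<in> I \<Longrightarrow> z i = cnj (a (s i)) * y (s i)"
    by (auto simp: perm_op_def)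
  have bij: "bij_betw s I I"
    by (rule bij_betw_byWitness[where f' = s]) (use s ss in auto)
  have "ell2_inner I y x' = ell2_inner I z x" if "(x, x') \<in> perm_op I s a" for x x'
  proof -
    have x': "\<And>i. i \<in> I \<Longrightarrow> x' i = a i * x (s i)"
      using that by (auto simp: perm_op_def)
    have "ell2_inner I y x' = (\<Sum>\<^sub>\<infinity>i\<in>I. cnj (y (s i)) * x' (s i))"
      unfolding ell2_inner_def by (rule infsum_reindex_bij_betw[OF bij, symmetric])
    also have "\<dots> = ell2_inner I z x"
      unfolding ell2_inner_def by (intro infsum_cong) (simp add: z x' s ss)
    finally show ?thesis .
  qed
  then show "p \<in> op_adjoint I (perm_op I s a)"
    using p yz by (auto simp: op_adjoint_def)
qed

text \<open>The substance is the equality of domains. If \<open>x\<close> and its multiple by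
  \<open>b = |a|^2\<close> are both square-summable, then so is the intermediate vector, because
  \<open>b \<le> 1 + b^2\<close>.\<close>

lemma perm_op_comp_adjoint:
  assumes s: "\<And>i. i \<in> I \<Longrightarrow> s i \<in> I" "\<And>i. i \<notin> I \<Longrightarrow> s i \<notin> I" and ss: "\<And>i. s (s i) = i"
  shows "perm_op I s a O op_adjoint I (perm_op I s a) =
    diag_op I (\<lambda>i. of_real ((cmod (a (s i)))\<^sup>2))"
proof -
  have adj: "op_adjoint I (perm_op I s a) = perm_op I s (\<lambda>i. cnj (a (s i)))"
    by (rule op_adjoint_perm_op) (use s ss in auto)
  show ?thesis
  proof (intro set_eqI iffI)
    fix p assume "p \<in> perm_op I s a O op_adjoint I (perm_op I s a)"
    then show "p \<in> diag_op I (\<lambda>i. of_real ((cmod (a (s i)))\<^sup>2))"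
      unfolding adj
      by (auto simp: perm_op_def diag_op_def s ss complex_norm_square mult_ac simp del: of_real_power)
  next
    fix p assume "p \<in> diag_op I (\<lambda>i. of_real ((cmod (a (s i)))\<^sup>2))"
    then obtain x z where p: "p = (x, z)" and xz: "x \<in> ell2 I" "z \<in> ell2 I"
      and z: "\<And>i. i \<in> I \<Longrightarrow> z i = of_real ((cmod (a (s i)))\<^sup>2) * x i"
      by (auto simp: diag_op_def)
    \<comment> \<open>Composing \<open>u\<close> with \<open>s\<close> gives the image of
      \<open>x\<close> under \<open>perm_op I s a\<close>, the vector through which the product
      factors.\<close>
    define u where "u = (\<lambda>i. if i \<in> I then a (s i) * x i else 0)"
    have u: "u \<in> ell2 I"
    proof (rule ell2_dominated[OF xz])
      fix i assume i: "i \<in> I"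
      define b where "b = (cmod (a (s i)))\<^sup>2"
      have "b \<le> 1 + b\<^sup>2"
        using sum_squares_bound[of b 1] unfolding b_def
        by (smt (verit) zero_le_power2 power_one mult.right_neutral)
      then have "b * (cmod (x i))\<^sup>2 \<le> (1 + b\<^sup>2) * (cmod (x i))\<^sup>2"
        by (rule mult_right_mono) simp
      then show "(cmod (u i))\<^sup>2 \<le> 1 * (cmod (x i))\<^sup>2 + 1 * (cmod (z i))\<^sup>2"
        using i by (simp add: u_def z norm_mult power_mult_distrib b_def algebra_simps norm_power)
    qed (simp add: u_def)
    have bij: "bij_betw s I I"
      by (rule bij_betw_byWitness[where f' = s]) (use s ss in auto)
    have "(\<lambda>i. (cmod (u (s i)))\<^sup>2) summable_on I"
      using ell2_summable[OF u] summable_on_reindex_bij_betw[OF bij, of "\<lambda>i. (cmod (u i))\<^sup>2"] by simp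
    then have us: "(\<lambda>i. u (s i)) \<in> ell2 I"
      using s by (auto simp: ell2_def u_def)
    have "(x, \<lambda>i. u (s i)) \<in> perm_op I s a"
      using xz us by (auto simp: perm_op_def u_def s ss)
    moreover have "(\<lambda>i. u (s i), z) \<in> op_adjoint I (perm_op I s a)"
      unfolding adj
      using xz us by (auto simp: perm_op_def z u_def s ss complex_norm_square mult_ac simp del: of_real_power)
    ultimately show "p \<in> perm_op I s a O op_adjoint I (perm_op I s a)"
      using p by auto
  qed
qed

section \<open>Absolute value, functional calculus and trace of diagonal operators\<close>

lemma self_adjoint_diag_op: "self_adjoint I (diag_op I (\<lambda>i. of_real (a i)))"
  by (simp add: self_adjoint_def diag_op_eq_perm_op linear_operator_perm_op op_adjoint_perm_op)

lemma positive_self_adjoint_diag_op: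
  assumes "\<And>i. i \<in> I \<Longrightarrow> 0 \<le> a i"
  shows "positive_self_adjoint I (diag_op I (\<lambda>i. of_real (a i)))"
proof -
  have "0 \<le> Re (ell2_inner I x y)" if "(x, y) \<in> diag_op I (\<lambda>i. of_real (a i))" for x y
    using that assms
    by (auto simp: diag_op_def ell2_inner_real_weight[where a = a] intro!: infsum_nonneg)
  then show ?thesis
    by (auto simp: positive_self_adjoint_def self_adjoint_diag_op)
qed

text \<open>If \<open>A e = y\<close> and \<open>A y = \<lambda>\<^sup>2 e\<close> with \<open>\<lambda> > 0\<close>, then \<open>y - \<lambda> e\<close> would be an
  eigenvector of \<open>A\<close> with eigenvalue \<open>-\<lambda>\<close>, so \<open>y = \<lambda> e\<close> by positivity.\<close>

lemma positive_square_root_unique: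
  assumes A: "positive_self_adjoint I A"
    and sq: "A O A = diag_op I (\<lambda>i. of_real ((a i)\<^sup>2))"
    and a: "\<And>i. i \<in> I \<Longrightarrow> 0 < a i"
  shows "A = diag_op I (\<lambda>i. of_real (a i))"
proof -
  have lin: "linear_operator I A" and adj: "op_adjoint I A = A"
    and pos: "\<And>x y. (x, y) \<in> A \<Longrightarrow> 0 \<le> Re (ell2_inner I x y)"
    using A by (auto simp: positive_self_adjoint_def self_adjoint_def)
  have AI: "\<And>x y. (x, y) \<in> A \<Longrightarrow> x \<in> ell2 I \<and> y \<in> ell2 I"
    and comb: "\<And>x y x' y' c. (x, y) \<in> A \<Longrightarrow> (x', y') \<in> A \<Longrightarrow>
      ((\<lambda>i. c * x i + x' i), (\<lambda>i. c * y i + y' i)) \<in> A"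
    using lin unfolding linear_operator_def by blast+
  have ket: "(ket i, \<lambda>j. of_real (a i) * ket i j) \<in> A" if i: "i \<in> I" for i
  proof -
    have "(ket i, \<lambda>j. of_real ((a i)\<^sup>2) * ket i j) \<in> A O A"
      unfolding sq using i by (auto simp: diag_op_def ell2_ket ell2_ket_scaled) (auto simp: ket_def)
    then obtain y where y: "(ket i, y) \<in> A" "(y, \<lambda>j. of_real ((a i)\<^sup>2) * ket i j) \<in> A"
      by auto
    define z where "z = (\<lambda>j. - of_real (a i) * ket i j + y j)"
    have z: "(z, \<lambda>j. of_real (- a i) * z j) \<in> A"
      using comb[OF y, of "- of_real (a i)"] unfolding z_def
      by (simp add: algebra_simps power2_eq_square)
    have "0 \<le> (\<Sum>\<^sub>\<infinity>j\<in>I. - a i * (cmod (z j))\<^sup>2)"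
      using pos[OF z] ell2_inner_real_weight[of I "\<lambda>j. of_real (- a i) * z j" "\<lambda>_. - a i" z] by simp
    also have "\<dots> = - a i * (\<Sum>\<^sub>\<infinity>j\<in>I. (cmod (z j))\<^sup>2)"
      by (rule infsum_cmult_right')
    finally have "(\<Sum>\<^sub>\<infinity>j\<in>I. (cmod (z j))\<^sup>2) \<le> 0"
      using a[OF i] by (simp add: mult_le_0_iff)
    then have "(cmod (z j))\<^sup>2 = 0" if "j \<in> I" for j
      by (rule nonneg_infsum_le_0D) (use AI[OF z] that ell2_summable in auto)
    moreover have "z j = 0" if "j \<notin> I" for j
      using AI[OF z] that by (auto intro: ell2_outside)
    ultimately have "y = (\<lambda>j. of_real (a i) * ket i j)"
      unfolding z_def fun_eq_iff by (auto simp: add_eq_0_iff)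
    then show ?thesis using y(1) by simp
  qed
  \<comment> \<open>Symmetry of \<open>A\<close> and its known values on the basis determine each
    coordinate of the image of any vector in its domain.\<close>
  have sub: "A \<subseteq> diag_op I (\<lambda>i. of_real (a i))"
  proof
    fix p assume "p \<in> A"
    then obtain x y where p: "p = (x, y)" and xy: "(x, y) \<in> A" by (cases p) auto
    then have *: "(x, y) \<in> op_adjoint I A" by (simp add: adj)
    have "y i = of_real (a i) * x i" if i: "i \<in> I" for i
    proof -
      have "ell2_inner I x (\<lambda>j. of_real (a i) * ket i j) = ell2_inner I y (ket i)"
        using * ket[OF i] by (auto simp: op_adjoint_def)
      then have "cnj (x i) * of_real (a i) = cnj (y i)"
        using ell2_inner_ket_right[OF i, of x "of_real (a i)"] ell2_inner_ket_right[OF i, of y 1] by simp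
      then show ?thesis
        by (metis complex_cnj_cnj complex_cnj_complex_of_real complex_cnj_mult mult.commute)
    qed
    then show "p \<in> diag_op I (\<lambda>i. of_real (a i))"
      using AI[OF xy] p by (auto simp: diag_op_def)
  qed
  \<comment> \<open>Taking adjoints reverses inclusions, so a self-adjoint operator has no proper
    self-adjoint extension.\<close>
  moreover have "diag_op I (\<lambda>i. of_real (a i)) \<subseteq> A"
  proof -
    have "op_adjoint I (diag_op I (\<lambda>i. of_real (a i))) \<subseteq> op_adjoint I A"
      using sub by (auto simp: op_adjoint_def)
    then show ?thesis
      using self_adjoint_diag_op[of I a] by (simp add: self_adjoint_def adj)
  qed
  ultimately show ?thesis by auto
qed

text \<open>Nonzero weights make the entries of the diagonal candidate strictly positive, which is
  what uniqueness of the square root requires.\<close>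

lemma op_abs_perm_op:
  assumes s: "\<And>i. i \<in> I \<Longrightarrow> s i \<in> I" "\<And>i. i \<notin> I \<Longrightarrow> s i \<notin> I" and ss: "\<And>i. s (s i) = i"
    and a: "\<And>i. i \<in> I \<Longrightarrow> a i \<noteq> 0"
  shows "op_abs I (perm_op I s a) = diag_op I (\<lambda>i. of_real (cmod (a (s i))))"
proof -
  have comp: "perm_op I s a O op_adjoint I (perm_op I s a) =
      diag_op I (\<lambda>i. of_real ((cmod (a (s i)))\<^sup>2))"
    by (rule perm_op_comp_adjoint) (use s ss in auto)
  show ?thesis
    unfolding op_abs_def comp
  proof (rule the_equality)
    let ?D = "diag_op I (\<lambda>i. of_real (cmod (a (s i))))"
    have "op_adjoint I ?D = ?D"
      using self_adjoint_diag_op[of I "\<lambda>i. cmod (a (s i))"] by (simp add: self_adjoint_def)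
    then have "?D O ?D = diag_op I (\<lambda>i. of_real ((cmod (a (s i)))\<^sup>2))"
      using perm_op_comp_adjoint[of I "\<lambda>i. i" "\<lambda>i. of_real (cmod (a (s i)))"]
      by (simp add: diag_op_eq_perm_op)
    then show "positive_self_adjoint I ?D \<and>
        ?D O ?D = diag_op I (\<lambda>i. of_real ((cmod (a (s i)))\<^sup>2))"
      by (simp add: positive_self_adjoint_diag_op)
  next
    fix A assume "positive_self_adjoint I A \<and> A O A = diag_op I (\<lambda>i. of_real ((cmod (a (s i)))\<^sup>2))"
    then show "A = diag_op I (\<lambda>i. of_real (cmod (a (s i))))"
      using positive_square_root_unique[of I A "\<lambda>i. cmod (a (s i))"] s a by auto
  qed
qed

lemma op_abs_diag_op:
  assumes "\<And>i. i \<in> I \<Longrightarrow> 0 < a i"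
  shows "op_abs I (diag_op I (\<lambda>i. of_real (a i))) = diag_op I (\<lambda>i. of_real (a i))"
proof -
  have "op_abs I (diag_op I (\<lambda>i. of_real (a i))) = diag_op I (\<lambda>i. of_real (cmod (of_real (a i))))"
    unfolding diag_op_eq_perm_op[of I "\<lambda>i. complex_of_real (a i)"]
    by (rule op_abs_perm_op) (use assms in force)+
  also have "\<dots> = diag_op I (\<lambda>i. of_real (a i))"
    using assms by (intro diag_op_cong) (simp add: less_imp_le)
  finally show ?thesis .
qed

lemma bounded_operator_diag_op:
  assumes "\<And>i. i \<in> I \<Longrightarrow> cmod (e i) \<le> C"
  shows "bounded_operator I (diag_op I e)"
proof -
  have le: "(cmod (e i * x i))\<^sup>2 \<le> C\<^sup>2 * (cmod (x i))\<^sup>2" if "i \<in> I" for i and x :: "'a \<Rightarrow> complex"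
    unfolding norm_mult power_mult_distrib
    using assms[OF that] by (intro mult_right_mono power_mono) auto
  have "Domain (diag_op I e) = ell2 I"
  proof (intro set_eqI iffI)
    fix x assume x: "x \<in> ell2 I"
    have "(\<lambda>i. if i \<in> I then e i * x i else 0) \<in> ell2 I"
      by (rule ell2_dominated[OF x x, of _ "C\<^sup>2" 0]) (use le in auto)
    then have "(x, \<lambda>i. if i \<in> I then e i * x i else 0) \<in> diag_op I e"
      using x by (auto simp: diag_op_def)
    then show "x \<in> Domain (diag_op I e)" by auto
  qed (auto simp: diag_op_def)
  \<comment> \<open>The absolute value covers an empty \<open>I\<close>, where \<open>C\<close> may
    be negative.\<close>
  moreover have "ell2_norm I y \<le> \<bar>C\<bar> * ell2_norm I x" if "(x, y) \<in> diag_op I e" for x y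
  proof -
    have xy: "x \<in> ell2 I" "y \<in> ell2 I" "\<And>i. i \<in> I \<Longrightarrow> y i = e i * x i"
      using that by (auto simp: diag_op_def)
    have "(\<Sum>\<^sub>\<infinity>i\<in>I. (cmod (y i))\<^sup>2) \<le> (\<Sum>\<^sub>\<infinity>i\<in>I. C\<^sup>2 * (cmod (x i))\<^sup>2)"
      using xy le by (intro infsum_mono ell2_summable summable_on_cmult_right) auto
    also have "\<dots> = C\<^sup>2 * (\<Sum>\<^sub>\<infinity>i\<in>I. (cmod (x i))\<^sup>2)"
      by (rule infsum_cmult_right')
    finally have "ell2_norm I y \<le> sqrt (C\<^sup>2 * (\<Sum>\<^sub>\<infinity>i\<in>I. (cmod (x i))\<^sup>2))"
      unfolding ell2_norm_def by (rule real_sqrt_le_mono)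
    then show ?thesis
      by (simp add: ell2_norm_def real_sqrt_mult)
  qed
  ultimately show ?thesis
    unfolding bounded_operator_def using linear_operator_perm_op[of I "\<lambda>i. i" e]
    by (auto simp: diag_op_eq_perm_op)
qed

text \<open>Every vector is the limit of its finite truncations.\<close>

lemma bounded_operator_eq_diag_op:
  assumes B: "bounded_operator I B"
    and kets: "\<And>i. i \<in> I \<Longrightarrow> (ket i, \<lambda>j. e i * ket i j) \<in> B"
  shows "B = diag_op I e"
proof -
  from B obtain C where lin: "linear_operator I B" and dom: "Domain B = ell2 I"
    and C: "\<And>x y. (x, y) \<in> B \<Longrightarrow> ell2_norm I y \<le> C * ell2_norm I x"
    unfolding bounded_operator_def by blast
  have BI: "\<And>x y. (x, y) \<in> B \<Longrightarrow> x \<in> ell2 I \<and> y \<in> ell2 I"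
    and zero: "((\<lambda>_. 0), (\<lambda>_. 0)) \<in> B"
    and comb: "\<And>x y x' y' c. (x, y) \<in> B \<Longrightarrow> (x', y') \<in> B \<Longrightarrow>
      ((\<lambda>i. c * x i + x' i), (\<lambda>i. c * y i + y' i)) \<in> B"
    using lin unfolding linear_operator_def by blast+
  have trunc: "((\<lambda>i. if i \<in> F then x i else 0), (\<lambda>i. if i \<in> F then e i * x i else 0)) \<in> B"
    if "finite F" "F \<subseteq> I" for F x
    using that
  proof (induction F rule: finite_induct)
    case (insert k F)
    have "(\<lambda>i. x k * ket k i + (if i \<in> F then x i else 0)) = (\<lambda>i. if i \<in> insert k F then x i else 0)"
      "(\<lambda>i. x k * (e k * ket k i) + (if i \<in> F then e i * x i else 0)) =
        (\<lambda>i. if i \<in> insert k F then e i * x i else 0)"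
      using insert.hyps by (auto simp: ket_def)
    then show ?case
      using comb[OF kets[of k] insert.IH, of "x k"] insert.prems by simp
  qed (simp add: zero)
  have sub: "B \<subseteq> diag_op I e"
  proof
    fix p assume "p \<in> B"
    then obtain x y where p: "p = (x, y)" and xy: "(x, y) \<in> B" by (cases p) auto
    let ?S = "\<Sum>\<^sub>\<infinity>i\<in>I. (cmod (x i))\<^sup>2"
    have "y i = e i * x i" if i: "i \<in> I" for i
    proof -
      \<comment> \<open>Subtract from \<open>x\<close> its truncation to \<open>F\<close>.
        Coordinate \<open>i\<close> of the image of the remainder is exactly the error, and
        boundedness controls it by the norm of the tail.\<close>
      have est: "cmod (y i - e i * x i) \<le> C * sqrt (?S - (\<Sum>j\<in>F. (cmod (x j))\<^sup>2))"
        if F: "finite F" "F \<subseteq> I" "i \<in> F" for F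
      proof -
        define u where "u = (\<lambda>j. - 1 * (if j \<in> F then x j else 0) + x j)"
        define v where "v = (\<lambda>j. - 1 * (if j \<in> F then e j * x j else 0) + y j)"
        have uv: "(u, v) \<in> B"
          unfolding u_def v_def by (rule comb[OF trunc[OF F(1,2)] xy])
        have "?S = (\<Sum>\<^sub>\<infinity>j\<in>F \<union> (I - F). (cmod (x j))\<^sup>2)"
          using F by (intro arg_cong2[where f = infsum]) auto
        also have "\<dots> = (\<Sum>j\<in>F. (cmod (x j))\<^sup>2) + (\<Sum>\<^sub>\<infinity>j\<in>I - F. (cmod (x j))\<^sup>2)"
          using F BI[OF xy]
          by (subst infsum_Un_disjoint) (auto intro: summable_on_subset_banach[OF ell2_summable])
        also have "(\<Sum>\<^sub>\<infinity>j\<in>I - F. (cmod (x j))\<^sup>2) = (\<Sum>\<^sub>\<infinity>j\<in>I. (cmod (u j))\<^sup>2)"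
          by (intro infsum_cong_neutral) (auto simp: u_def)
        finally have norm_u: "ell2_norm I u = sqrt (?S - (\<Sum>j\<in>F. (cmod (x j))\<^sup>2))"
          by (simp add: ell2_norm_def)
        have "cmod (y i - e i * x i) = cmod (v i)"
          using F by (simp add: v_def)
        also have "\<dots> \<le> ell2_norm I v"
          using BI[OF uv] i by (intro ell2_norm_coordinate) auto
        also have "\<dots> \<le> C * ell2_norm I u" by (rule C[OF uv])
        finally show ?thesis by (simp add: norm_u)
      qed
      have "((\<lambda>F. \<Sum>j\<in>F. (cmod (x j))\<^sup>2) \<longlongrightarrow> ?S) (finite_subsets_at_top I)"
        using BI[OF xy] by (intro infsum_tendsto ell2_summable) auto
      then have lim: "((\<lambda>F. C * sqrt (?S - (\<Sum>j\<in>F. (cmod (x j))\<^sup>2))) \<longlongrightarrow> C * sqrt (?S - ?S))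
          (finite_subsets_at_top I)"
        by (intro tendsto_intros)
      have "\<forall>\<^sub>F F in finite_subsets_at_top I.
          cmod (y i - e i * x i) \<le> C * sqrt (?S - (\<Sum>j\<in>F. (cmod (x j))\<^sup>2))"
        unfolding eventually_finite_subsets_at_top
        \<comment> \<open>The estimate holds once \<open>F\<close> contains \<open>i\<close>, so
          \<open>{i}\<close> is the threshold set.\<close>
        using est i by (intro exI[of _ "{i}"]) auto
      from tendsto_lowerbound[OF lim this] show ?thesis by simp
    qed
    then show "p \<in> diag_op I e"
      using BI[OF xy] p by (auto simp: diag_op_def)
  qed
  \<comment> \<open>\<open>B\<close> is defined everywhere, so a single-valued extension of it adds
    nothing.\<close>
  moreover have "diag_op I e \<subseteq> B"
  proof
    fix p assume p: "p \<in> diag_op I e"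
    then obtain y where y: "(fst p, y) \<in> B"
      using dom by (force simp: diag_op_def)
    have "single_valued (diag_op I e)"
      using linear_operator_perm_op[of I "\<lambda>i. i" e] by (simp add: diag_op_eq_perm_op linear_operator_def)
    then have "snd p = y"
      using p y sub by (metis prod.collapse single_valuedD subsetD)
    then show "p \<in> B" using y by (metis prod.collapse)
  qed
  ultimately show ?thesis by auto
qed

text \<open>The basis vectors are eigenvectors, so the defining condition prescribes the operator on
  them, and boundedness extends this to all vectors.\<close>

lemma op_fun_diag_op:
  assumes C: "\<And>i. i \<in> I \<Longrightarrow> cmod (f (a i)) \<le> C"
  shows "op_fun I f (diag_op I (\<lambda>i. of_real (a i))) = diag_op I (\<lambda>i. f (a i))"
  unfolding op_fun_def
proof (rule the_equality)
  \<comment> \<open>An eigenvector for \<open>s\<close> is supported on the indices with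
    \<open>a i = s\<close>, where \<open>f s\<close> and \<open>f (a i)\<close> agree.\<close>
  have "(x, \<lambda>i. f s * x i) \<in> diag_op I (\<lambda>i. f (a i))"
    if "(x, \<lambda>i. of_real s * x i) \<in> diag_op I (\<lambda>i. of_real (a i))" for x s
    using that by (auto simp: diag_op_def ell2_scale)
  then show "bounded_operator I (diag_op I (\<lambda>i. f (a i))) \<and>
      (\<forall>x s. (x, \<lambda>i. of_real s * x i) \<in> diag_op I (\<lambda>i. of_real (a i)) \<longrightarrow>
        (x, \<lambda>i. f s * x i) \<in> diag_op I (\<lambda>i. f (a i)))"
    using bounded_operator_diag_op[of I "\<lambda>i. f (a i)" C] C by auto
next
  fix B assume B: "bounded_operator I B \<and>
      (\<forall>x s. (x, \<lambda>i. of_real s * x i) \<in> diag_op I (\<lambda>i. of_real (a i)) \<longrightarrow> (x, \<lambda>i. f s * x i) \<in> B)"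
  have "(ket i, \<lambda>j. of_real (a i) * ket i j) \<in> diag_op I (\<lambda>i. of_real (a i))" if "i \<in> I" for i
    using that by (auto simp: diag_op_def ell2_ket ell2_ket_scaled) (auto simp: ket_def)
  then show "B = diag_op I (\<lambda>i. f (a i))"
    using B by (intro bounded_operator_eq_diag_op) auto
qed

lemma op_apply_diag_op_ket:
  assumes "i \<in> I"
  shows "op_apply (diag_op I e) (ket i) = (\<lambda>j. e i * ket i j)"
  unfolding op_apply_def
proof (rule the_equality)
  show *: "(ket i, \<lambda>j. e i * ket i j) \<in> diag_op I e"
    using assms by (auto simp: diag_op_def ell2_ket ell2_ket_scaled) (auto simp: ket_def)
  show "y = (\<lambda>j. e i * ket i j)" if "(ket i, y) \<in> diag_op I e" for y
    using that * linear_operator_perm_op[of I "\<lambda>i. i" e]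
    by (auto simp: diag_op_eq_perm_op linear_operator_def dest: single_valuedD)
qed

lemma ell2_inner_diag_op_ket:
  "i \<in> I \<Longrightarrow> ell2_inner I (ket i) (op_apply (diag_op I e) (ket i)) = e i"
  by (simp add: op_apply_diag_op_ket ell2_inner_ket_left) (simp add: ket_def)

lemma op_exp_neg_diag_op:
  assumes "t > 0" and "\<And>i. i \<in> I \<Longrightarrow> 0 \<le> a i"
  shows "op_exp_neg I t (diag_op I (\<lambda>i. of_real (a i))) = diag_op I (\<lambda>i. of_real (exp (- t * a i)))"
  unfolding op_exp_neg_def using assms
  by (intro op_fun_diag_op[where C = 1]) simp

text \<open>The heat operator is diagonal with positive entries, hence its own absolute value; being
  trace class then amounts to summability of those entries.\<close>

lemma trace_class_op_exp_neg_diag_op: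
  assumes "t > 0" and "\<And>i. i \<in> I \<Longrightarrow> 0 \<le> a i" and "(\<lambda>i. exp (- t * a i)) summable_on I"
  shows "trace_class I (op_exp_neg I t (diag_op I (\<lambda>i. of_real (a i))))"
proof -
  let ?D = "diag_op I (\<lambda>i. of_real (exp (- t * a i)))"
  have "op_exp_neg I t (diag_op I (\<lambda>i. of_real (a i))) = ?D"
    by (rule op_exp_neg_diag_op) (use assms in auto)
  moreover
  have "bounded_operator I ?D"
    using assms by (intro bounded_operator_diag_op[where C = 1]) simp
  moreover have "op_abs I ?D = ?D"
    by (rule op_abs_diag_op) simp
  moreover have "(\<lambda>i. ell2_inner I (ket i) (op_apply ?D (ket i))) summable_on I \<longleftrightarrow>
      (\<lambda>i. complex_of_real (exp (- t * a i))) summable_on I"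
    by (intro summable_on_cong ell2_inner_diag_op_ket)
  ultimately show ?thesis
    unfolding trace_class_def
    using summable_on_of_real[OF assms(3)] by simp
qed

lemma op_trace_op_exp_neg_diag_op:
  assumes "t > 0" and "\<And>i. i \<in> I \<Longrightarrow> 0 \<le> a i"
  shows "op_trace I (op_exp_neg I t (diag_op I (\<lambda>i. of_real (a i)))) =
    (\<Sum>\<^sub>\<infinity>i\<in>I. complex_of_real (exp (- t * a i)))"
proof -
  have "op_exp_neg I t (diag_op I (\<lambda>i. of_real (a i))) = diag_op I (\<lambda>i. of_real (exp (- t * a i)))"
    by (rule op_exp_neg_diag_op) (use assms in auto)
  then show ?thesis
    unfolding op_trace_def by (auto intro!: infsum_cong simp: ell2_inner_diag_op_ket)
qed

section \<open>The Dirac operators as weighted permutation operators\<close>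

lemma ball_Plus: "(\<forall>i\<in>I <+> J. P i) \<longleftrightarrow> (\<forall>i\<in>I. P (Inl i)) \<and> (\<forall>j\<in>J. P (Inr j))"
  by auto

lemma ell2_Plus_iff:
  "x \<in> ell2 (I <+> J) \<longleftrightarrow> x \<circ> Inl \<in> ell2 I \<and> x \<circ> Inr \<in> ell2 J"
proof -
  let ?f = "\<lambda>i. (cmod (x i))\<^sup>2"
  have "?f summable_on (I <+> J) \<longleftrightarrow> ?f summable_on (Inl ` I) \<and> ?f summable_on (Inr ` J)"
    unfolding Plus_def
    by (auto intro: summable_on_subset_banach summable_on_Un_disjoint)
  moreover have "(\<forall>i. i \<notin> I <+> J \<longrightarrow> x i = 0) \<longleftrightarrow>
      (\<forall>i. i \<notin> I \<longrightarrow> x (Inl i) = 0) \<and> (\<forall>j. j \<notin> J \<longrightarrow> x (Inr j) = 0)"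
    by (subst split_sum_all) auto
  ultimately show ?thesis
    by (auto simp: ell2_def summable_on_reindex o_def)
qed

lemma block_diag_diag_op:
  "block_diag (diag_op I a) (diag_op J b) = diag_op (I <+> J) (case_sum a b)"
  by (auto simp: block_diag_def diag_op_def ell2_Plus_iff ball_Plus)

lemma block_antidiag_diag_op:
  "block_antidiag (diag_op I a) (diag_op I b) =
    perm_op (I <+> I) (case_sum Inr Inl) (case_sum a b)"
  by (auto simp: block_antidiag_def diag_op_def perm_op_def ell2_Plus_iff ball_Plus)

text \<open>Scaling keeps the domain, whereas zero entries would give all of \<open>ell2 I\<close>;
  for \<open>c \<noteq> 0\<close> the maximal domains match after dividing by
  \<open>c\<close>.\<close>

lemma op_scale_diag_op:
  assumes "c \<noteq> 0"
  shows "op_scale c (diag_op I a) = diag_op I (\<lambda>i. c * a i)"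
proof (intro set_eqI iffI)
  fix p assume "p \<in> op_scale c (diag_op I a)"
  then show "p \<in> diag_op I (\<lambda>i. c * a i)"
    by (auto simp: op_scale_def diag_op_def ell2_scale)
next
  fix p assume "p \<in> diag_op I (\<lambda>i. c * a i)"
  then obtain x y where p: "p = (x, y)" and xy: "x \<in> ell2 I" "y \<in> ell2 I"
    "\<forall>i\<in>I. y i = c * a i * x i"
    by (auto simp: diag_op_def)
  have "(x, \<lambda>i. inverse c * y i) \<in> diag_op I a"
    using xy assms by (auto simp: diag_op_def ell2_scale mult.assoc)
  then show "p \<in> op_scale c (diag_op I a)"
    unfolding op_scale_def using p assms by (force simp: mult.assoc[symmetric])
qed

text \<open>The label \<open>n\<close> common to both spectra, \<open>|w| [n]\<close> with the
  q-number and \<open>|w| n\<close>, which allows the traces to be compared term by term.\<close>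

definition spin_level :: "real \<times> real + real \<times> real \<Rightarrow> real" where
  "spin_level = case_sum (\<lambda>(l, m). l + 1 / 2) (\<lambda>(l, m). l + 1 / 2)"

lemma spin_level_nat:
  assumes "i \<in> spinor_idx"
  obtains n :: nat where "spin_level i = real n" "n \<ge> 1"
proof -
  from assms obtain k :: nat where "spin_level i = 1 / 2 + real k + 1 / 2"
    by (auto simp: spinor_idx_def spin_idx_def spin_level_def)
  \<comment> \<open>The two halves in \<open>l + 1 / 2\<close> add up to 1, hence the
    successor.\<close>
  then show ?thesis using that[of "Suc k"] by simp
qed

lemma abs_sphere_dirac_eq:
  "abs_sphere_dirac w = diag_op spinor_idx (\<lambda>i. of_real (cmod w * spin_level i))"
  unfolding abs_sphere_dirac_def Let_def block_diag_diag_op spinor_idx_def[symmetric]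
  by (rule diag_op_cong) (auto simp: spin_level_def split: sum.split)

text \<open>\<open>w\<close> and \<open>cnj w\<close> have equal modulus and the level does not see
  which summand an index lies in, so neither the phase nor the exchange survives in the absolute
  value.\<close>

lemma op_abs_podles_dirac:
  assumes "w \<noteq> 0" and pos: "\<And>i. i \<in> spinor_idx \<Longrightarrow> 0 < qnum q (spin_level i)"
  shows "op_abs spinor_idx (podles_dirac q w) =
    diag_op spinor_idx (\<lambda>i. of_real (cmod w * qnum q (spin_level i)))"
proof -
  let ?d = "\<lambda>(l, m). complex_of_real (qnum q (l + 1 / 2))"
  let ?a = "case_sum (\<lambda>i. cnj w * ?d i) (\<lambda>i. w * ?d i)"
  have "podles_dirac q w = perm_op spinor_idx (case_sum Inr Inl) ?a"
    unfolding podles_dirac_def half_dirac_def spinor_idx_def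
    using assms(1) by (simp add: op_scale_diag_op block_antidiag_diag_op)
  moreover have "op_abs spinor_idx (perm_op spinor_idx (case_sum Inr Inl) ?a) =
      diag_op spinor_idx (\<lambda>i. of_real (cmod (?a (case_sum Inr Inl i))))"
  proof (rule op_abs_perm_op)
    show "?a i \<noteq> 0" if "i \<in> spinor_idx" for i
      using pos[OF that] assms(1) by (auto simp: spin_level_def split: sum.splits prod.splits)
  qed (auto simp: spinor_idx_def split: sum.splits)
  moreover have "cmod (?a (case_sum Inr Inl i)) = cmod w * qnum q (spin_level i)"
    if "i \<in> spinor_idx" for i
    using pos[OF that] by (auto simp: spin_level_def norm_mult split: sum.splits prod.splits)
  ultimately show ?thesis
    by (simp cong: diag_op_cong)
qed

section \<open>Convergence of the heat traces\<close>

text \<open>The addition formula together with \<open>cosh \<ge> 1\<close> drives the induction.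
  Divided by \<open>sinh s\<close>, this is the bound of the q-number by \<open>n\<close> from
  below.\<close>

lemma sinh_nat_mult_ge:
  fixes s :: real
  assumes "s \<ge> 0"
  shows "real n * sinh s \<le> sinh (real n * s)"
proof (induction n)
  case (Suc n)
  have "real (Suc n) * sinh s = real n * sinh s + sinh s"
    by (simp add: algebra_simps)
  also have "\<dots> \<le> sinh (real n * s) * cosh s + cosh (real n * s) * sinh s"
  proof (rule add_mono)
    have "real n * sinh s \<le> sinh (real n * s) * 1"
      using Suc by simp
    also have "\<dots> \<le> sinh (real n * s) * cosh s"
      using assms by (intro mult_left_mono cosh_real_ge_1) simp
    finally show "real n * sinh s \<le> sinh (real n * s) * cosh s" .
    show "sinh s \<le> cosh (real n * s) * sinh s"
      using mult_right_mono[OF cosh_real_ge_1[of "real n * s"], of "sinh s"] assms by simp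
  qed
  also have "\<dots> = sinh (real (Suc n) * s)"
    by (simp add: sinh_add distrib_right add.commute)
  finally show ?case .
qed simp

lemma qnum_eq_sinh:
  assumes "0 < q"
  shows "qnum q n = sinh (n * - ln q) / sinh (- ln q)"
proof -
  have eqs: "sinh (n * - ln q) = (q powr - n - q powr n) / 2" "sinh (- ln q) = (inverse q - q) / 2"
    using assms by (simp_all add: sinh_field_def powr_def exp_minus)
  \<comment> \<open>Division by zero yields 0, so this cancellation also covers
    \<open>q = 1\<close>.\<close>
  have "u / v = (u / 2) / (v / 2)" for u v :: real by simp
  then show ?thesis unfolding qnum_def eqs .
qed

lemma qnum_ge:
  assumes "0 < q" and "q < 1"
  shows "real n \<le> qnum q (real n)"
proof -
  have "0 < sinh (- ln q)"
    unfolding sinh_real_pos_iff using assms by simp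
  then show ?thesis
    unfolding qnum_eq_sinh[OF assms(1)]
    using assms sinh_nat_mult_ge[of "- ln q" n] by (simp only: pos_le_divide_eq) simp
qed

text \<open>Numerator and denominator both vanish to first order at \<open>q = 1\<close>, with
  slopes in ratio \<open>n\<close>.\<close>

lemma tendsto_qnum: "((\<lambda>q. qnum q n) \<longlongrightarrow> n) (at_left 1)"
  unfolding qnum_def by real_asymp

text \<open>Instead of counting multiplicities, part of the decay in \<open>n\<close> is spent on
  the second index, so that a product of two geometric series dominates.\<close>

lemma summable_on_exp_spin_level:
  assumes "c > 0"
  shows "(\<lambda>i. exp (- c * spin_level i)) summable_on spinor_idx"
proof -
  define g :: "nat \<Rightarrow> nat \<Rightarrow> real" where "g = (\<lambda>n j. exp (- c / 2) ^ n * exp (- c / 4) ^ j)"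
  have geo: "(\<lambda>n. exp (- d) ^ n) summable_on (UNIV :: nat set)" if "d > 0" for d :: real
    by (rule summable_nonneg_imp_summable_on) (use that in \<open>auto intro!: summable_geometric\<close>)
  have g: "(\<lambda>(n, j). g n j) summable_on (UNIV \<times> UNIV)"
  proof (rule summable_on_SigmaI)
    show "((\<lambda>j. case (n, j) of (n, j) \<Rightarrow> g n j) has_sum
        exp (- c / 2) ^ n * (\<Sum>\<^sub>\<infinity>j. exp (- c / 4) ^ j)) UNIV" for n
      unfolding g_def using geo[of "c / 4"] assms
      by (auto intro!: has_sum_cmult_right has_sum_infsum)
    show "(\<lambda>n. exp (- c / 2) ^ n * (\<Sum>\<^sub>\<infinity>j. exp (- c / 4) ^ j)) summable_on (UNIV :: nat set)"
      using geo[of "c / 2"] assms by (intro summable_on_cmult_left) auto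
  qed (auto simp: g_def)
  \<comment> \<open>With \<open>l = 1 / 2 + n\<close> and \<open>m = - l + j\<close>, the condition
    \<open>m \<le> l\<close> reads \<open>j \<le> 2 * n + 1\<close>.\<close>
  define P :: "(nat \<times> nat) set" where "P = {(n, j). j \<le> 2 * n + 1}"
  define h :: "nat \<times> nat \<Rightarrow> real \<times> real" where
    "h = (\<lambda>(n, j). (1 / 2 + real n, - (1 / 2 + real n) + real j))"
  have inj: "inj_on h P"
    by (auto simp: inj_on_def h_def)
  have img: "h ` P = spin_idx"
  proof (intro set_eqI iffI)
    fix p assume "p \<in> h ` P"
    then show "p \<in> spin_idx" by (auto simp: h_def P_def spin_idx_def)
  next
    fix p assume "p \<in> spin_idx"
    then obtain n j :: nat where p: "p = (1 / 2 + real n, - (1 / 2 + real n) + real j)"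
      "- (1 / 2 + real n) + real j \<le> 1 / 2 + real n"
      by (auto simp: spin_idx_def)
    then have "real j \<le> real (2 * n + 1)" by simp
    then have "(n, j) \<in> P" unfolding P_def by (simp only: of_nat_le_iff) simp
    then show "p \<in> h ` P" using p by (auto simp: h_def)
  qed
  \<comment> \<open>From \<open>j \<le> 2 * n + 1\<close> follows
    \<open>n / 2 + j / 4 \<le> n + 1 / 4\<close>, which explains the rates \<open>c / 2\<close> and
    \<open>c / 4\<close>.\<close>
  have le: "exp (- c * (real n + 1)) \<le> g n j" if "j \<le> 2 * n + 1" for n j
  proof -
    have "real j \<le> real (2 * n + 1)" using that by (simp only: of_nat_le_iff)
    then have "c * (real n / 2 + real j / 4) \<le> c * (real n + 1)"
      using assms by (intro mult_left_mono) auto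
    then show ?thesis
      by (simp add: g_def exp_of_nat_mult[symmetric] exp_add[symmetric] algebra_simps)
  qed
  have "(\<lambda>(n, j). exp (- c * (real n + 1))) summable_on P"
    by (rule summable_on_comparison_test[OF summable_on_subset_banach[OF g]])
      (use le in \<open>auto simp: P_def\<close>)
  then have "((\<lambda>(l, m). exp (- c * (l + 1 / 2))) \<circ> h) summable_on P"
    by (rule summable_on_cong[THEN iffD1, rotated]) (auto simp: h_def)
  then have spin: "(\<lambda>(l, m). exp (- c * (l + 1 / 2))) summable_on spin_idx"
    using summable_on_reindex[OF inj] img by metis
  have "(\<lambda>i. exp (- c * spin_level i)) \<circ> Inl = (\<lambda>(l, m). exp (- c * (l + 1 / 2)))"
    "(\<lambda>i. exp (- c * spin_level i)) \<circ> Inr = (\<lambda>(l, m). exp (- c * (l + 1 / 2)))"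
    by (auto simp: spin_level_def)
  then show ?thesis
    unfolding spinor_idx_def Plus_def using spin
    by (intro summable_on_Un_disjoint) (auto simp: summable_on_reindex)
qed

text \<open>The trace class clauses guarantee that the traces are genuine sums:
  \<open>op_trace\<close> would silently be 0 for a divergent family.\<close>

theorem proposition4p10:
  fixes w :: complex and t :: real
  assumes "w \<noteq> 0" and "t > 0"
  shows "(\<forall>q. 0 < q \<and> q < 1 \<longrightarrow>
            trace_class spinor_idx
              (op_exp_neg spinor_idx t (op_abs spinor_idx (podles_dirac q w)))) \<and>
         trace_class spinor_idx (op_exp_neg spinor_idx t (abs_sphere_dirac w)) \<and>
         ((\<lambda>q. op_trace spinor_idx
              (op_exp_neg spinor_idx t (op_abs spinor_idx (podles_dirac q w))))
            \<longlongrightarrow> op_trace spinor_idx (op_exp_neg spinor_idx t (abs_sphere_dirac w)))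
           (at_left 1)"
proof -
  let ?I = spinor_idx
  define a where "a = (\<lambda>q i. cmod w * qnum q (spin_level i))"
  define a1 where "a1 = (\<lambda>i. cmod w * spin_level i)"
  have level: "spin_level i \<le> qnum q (spin_level i)" "0 < spin_level i"
    if "i \<in> ?I" "0 < q" "q < 1" for q i
    using that qnum_ge by (auto elim!: spin_level_nat)
  have a1_nonneg: "0 \<le> a1 i" if "i \<in> ?I" for i
    \<comment> \<open>\<open>1 / 2\<close> is just some value in the open unit interval.\<close>
    using level(2)[OF that, of "1 / 2"] by (simp add: a1_def)
  have a1_le: "a1 i \<le> a q i" if "i \<in> ?I" "0 < q" "q < 1" for q i
    using level(1)[OF that] by (simp add: a_def a1_def mult_left_mono)
  have a_nonneg: "0 \<le> a q i" if "i \<in> ?I" "0 < q" "q < 1" for q i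
    using a1_nonneg a1_le that by force
  have abs: "op_abs ?I (podles_dirac q w) = diag_op ?I (\<lambda>i. of_real (a q i))" if "0 < q" "q < 1" for q
    unfolding a_def using level that assms(1) by (intro op_abs_podles_dirac) force+
  have abs1: "abs_sphere_dirac w = diag_op ?I (\<lambda>i. of_real (a1 i))"
    by (simp add: abs_sphere_dirac_eq a1_def)
  have sum1: "(\<lambda>i. exp (- t * a1 i)) summable_on ?I"
    using summable_on_exp_spin_level[of "t * cmod w"] assms by (simp add: a1_def mult.assoc)
  have exp_le: "exp (- t * a q i) \<le> exp (- t * a1 i)" if "i \<in> ?I" "0 < q" "q < 1" for q i
    using a1_le[OF that] assms by simp
  have sum: "(\<lambda>i. exp (- t * a q i)) summable_on ?I" if "0 < q" "q < 1" for q
    by (rule summable_on_comparison_test[OF sum1]) (use exp_le that in auto)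
  define H where "H = (\<lambda>q. \<Sum>\<^sub>\<infinity>i\<in>?I. complex_of_real (exp (- t * a q i)))"
  have trace: "op_trace ?I (op_exp_neg ?I t (op_abs ?I (podles_dirac q w))) = H q"
    if "0 < q" "q < 1" for q
    unfolding abs[OF that] H_def using a_nonneg that assms(2) by (intro op_trace_op_exp_neg_diag_op)
  have trace1: "op_trace ?I (op_exp_neg ?I t (abs_sphere_dirac w)) =
      (\<Sum>\<^sub>\<infinity>i\<in>?I. complex_of_real (exp (- t * a1 i)))"
    unfolding abs1 using a1_nonneg assms(2) by (intro op_trace_op_exp_neg_diag_op)
  \<comment> \<open>Uniform convergence is stated on a set of \<open>q\<close>, the limit along a
    filter; near 1 the two agree.\<close>
  have left: "at 1 within {0<..<1} = at_left (1 :: real)"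
    by (rule at_within_nhd[where S = "{0<..}"]) auto
  \<comment> \<open>Interchange of the limit over finite partial sums with the limit in
    \<open>q\<close>.\<close>
  have "(H \<longlongrightarrow> (\<Sum>\<^sub>\<infinity>i\<in>?I. complex_of_real (exp (- t * a1 i)))) (at 1 within {0<..<1})"
  proof (rule swap_uniform_limit)
    show "uniform_limit {0<..<1} (\<lambda>F q. \<Sum>i\<in>F. complex_of_real (exp (- t * a q i))) H
        (finite_subsets_at_top ?I)"
      unfolding H_def
      \<comment> \<open>The classical exponentials dominate for every \<open>q\<close> in the
        interval, so they serve as the majorant.\<close>
      by (rule Weierstrass_m_test_general[OF _ sum1]) (use exp_le in auto)
    show "((\<lambda>F. \<Sum>i\<in>F. complex_of_real (exp (- t * a1 i))) \<longlongrightarrow>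
        (\<Sum>\<^sub>\<infinity>i\<in>?I. complex_of_real (exp (- t * a1 i)))) (finite_subsets_at_top ?I)"
      using summable_on_of_real[OF sum1] by (rule infsum_tendsto)
    show "\<forall>\<^sub>F F in finite_subsets_at_top ?I.
        ((\<lambda>q. \<Sum>i\<in>F. complex_of_real (exp (- t * a q i))) \<longlongrightarrow>
          (\<Sum>i\<in>F. complex_of_real (exp (- t * a1 i)))) (at 1 within {0<..<1})"
      unfolding left a_def a1_def
      by (intro always_eventually allI tendsto_intros tendsto_qnum)
  qed simp
  \<comment> \<open>The traces are identified with \<open>H\<close> only for \<open>q\<close>
    between 0 and 1, which is enough for a left limit at 1.\<close>
  moreover have "\<forall>\<^sub>F q in at_left (1 :: real). 0 < q \<and> q < 1"
    by (intro eventually_at_leftI[of 0]) auto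
  then have "\<forall>\<^sub>F q in at_left 1.
      op_trace ?I (op_exp_neg ?I t (op_abs ?I (podles_dirac q w))) = H q"
    by (rule eventually_mono) (use trace in auto)
  ultimately have "((\<lambda>q. op_trace ?I (op_exp_neg ?I t (op_abs ?I (podles_dirac q w)))) \<longlongrightarrow>
      op_trace ?I (op_exp_neg ?I t (abs_sphere_dirac w))) (at_left 1)"
    unfolding trace1 left by (simp add: tendsto_cong)
  moreover have "trace_class ?I (op_exp_neg ?I t (abs_sphere_dirac w))"
    unfolding abs1 using a1_nonneg assms(2) sum1 by (intro trace_class_op_exp_neg_diag_op)
  moreover have "trace_class ?I (op_exp_neg ?I t (op_abs ?I (podles_dirac q w)))"
    if "0 < q" "q < 1" for q
    unfolding abs[OF that] using a_nonneg sum that assms(2)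
    by (intro trace_class_op_exp_neg_diag_op)
  ultimately show ?thesis by blast
qed

end
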